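(* Let $T$ be a Leech tree of order $n\ge 5$. Then the weighted forest formed by the three physical edges of smallest weight of $T$ (on the vertices incident with them) has, up to isomorphism preserving edge weights, one of the following eight forms. In each case the set $D$ of distances internal to its components and the weight $q$ of the next physical edge (the edge of smallest weight among the remaining edges of $T$) are as listed. \begin{enumerate} \item A path with successive edge weights $1,2$ and a separate (vertex-disjoint) edge of weight $4$; $D=\{1,2,3,4\}$, $q=5$. \item A path with successive edge weights $4,1,2$; $D=\{1,2,3,4,5,7\}$, $q=6$. \item A path with successive edge weights $1,2,4$; $D=\{1,2,3,4,6,7\}$, $q=5$. \item A three-edge star with edge weights $1,2,4$; $D=\{1,2,3,4,5,6\}$, $q=7$. \item Three pairwise vertex-disjoint edges with weights $1,2,3$; $D=\{1,2,3\}$, $q=4$. \item A path with successive edge weights $1,3$ and a separate edge of weight $2$; $D=\{1,2,3,4\}$, $q=5$. \item A separate edge of weight $1$ and a path with successive edge weights $2,3$; $D=\{1,2,3,5\}$, $q=4$. \item A path with successive edge weights $1,3,2$; $D=\{1,2,3,4,5,6\}$, $q=7$. \end{enumerate} These eight forms are exhaustive.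
   Context: A Leech tree of order $n$ is a finite simple tree $T=(V,E,w)$ with $|V|=n$ and positive integer edge weights $w$ such that the weighted distances $d_T(x,y)$ (sum of edge weights on the unique $x$--$y$ path), indexed by unordered pairs of distinct vertices, are exactly $1,2,\ldots,\binom n2$, each occurring once. In particular the edge weights of a Leech tree are pairwise distinct. A physical edge is an edge of $T$. The distances internal to a weighted forest are the weighted distances between two distinct vertices lying in the same component. *)

theory Defs
  imports Main
begin

text \<open>
  A simple graph is given by its vertex set and its set of edges, an edge being a
  two-element set of vertices.
\<close>

definition simple_graph :: "'a set \<Rightarrow> 'a set set \<Rightarrow> bool" where
  "simple_graph V E \<longleftrightarrow> finite V \<and> (\<forall>e\<in>E. e \<subseteq> V \<and> card e = 2)"

fun walk_edges :: "'a list \<Rightarrow> 'a set list" where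
  "walk_edges (x # y # xs) = {x, y} # walk_edges (y # xs)"
| "walk_edges [x] = []"
| "walk_edges [] = []"

definition path_between :: "'a set set \<Rightarrow> 'a \<Rightarrow> 'a list \<Rightarrow> 'a \<Rightarrow> bool" where
  "path_between E x p y \<longleftrightarrow>
     p \<noteq> [] \<and> hd p = x \<and> last p = y \<and> distinct p \<and> set (walk_edges p) \<subseteq> E"

definition connected_graph :: "'a set \<Rightarrow> 'a set set \<Rightarrow> bool" where
  "connected_graph V E \<longleftrightarrow> V \<noteq> {} \<and> (\<forall>x\<in>V. \<forall>y\<in>V. \<exists>p. path_between E x p y)"

definition has_cycle :: "'a set set \<Rightarrow> bool" where
  "has_cycle E \<longleftrightarrow>
     (\<exists>p. 3 \<le> length p \<and> distinct p \<and> set (walk_edges (p @ [hd p])) \<subseteq> E)"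

definition tree_graph :: "'a set \<Rightarrow> 'a set set \<Rightarrow> bool" where
  "tree_graph V E \<longleftrightarrow> simple_graph V E \<and> connected_graph V E \<and> \<not> has_cycle E"

text \<open>
  The weighted distance is meant for vertices joined by exactly one path of \<open>E\<close>: any two
  vertices of a tree, or two vertices in the same component of a forest.
\<close>

definition wdist :: "'a set set \<Rightarrow> ('a set \<Rightarrow> nat) \<Rightarrow> 'a \<Rightarrow> 'a \<Rightarrow> nat" where
  "wdist E w x y = sum_list (map w (walk_edges (THE p. path_between E x p y)))"

definition leech_tree :: "'a set \<Rightarrow> 'a set set \<Rightarrow> ('a set \<Rightarrow> nat) \<Rightarrow> bool" where
  "leech_tree V E w \<longleftrightarrow>
     tree_graph V E \<and> (\<forall>e\<in>E. 0 < w e) \<and>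
     (\<forall>x\<in>V. \<forall>y\<in>V. x \<noteq> y \<longrightarrow> wdist E w x y \<in> {1..card V choose 2}) \<and>
     (\<forall>k\<in>{1..card V choose 2}.
        \<exists>!P. \<exists>x\<in>V. \<exists>y\<in>V. x \<noteq> y \<and> P = {x, y} \<and> wdist E w x y = k)"

text \<open>
  If the weights are pairwise distinct on \<open>E\<close> and \<open>E\<close> has at least \<open>k\<close> edges, these are
  exactly the \<open>k\<close> edges of smallest weight.
\<close>

definition lightest_edges :: "nat \<Rightarrow> 'a set set \<Rightarrow> ('a set \<Rightarrow> nat) \<Rightarrow> 'a set set" where
  "lightest_edges k E w = {e \<in> E. card {f \<in> E. w f < w e} < k}"

definition internal_distances :: "'a set set \<Rightarrow> ('a set \<Rightarrow> nat) \<Rightarrow> nat set" where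
  "internal_distances F w = {wdist F w x y | x y. x \<noteq> y \<and> (\<exists>p. path_between F x p y)}"

text \<open>
  A weighted graph without isolated vertices is recorded as its set of pairs
  (edge, weight); its vertices are those incident with some edge.
\<close>

definition weighted :: "'a set set \<Rightarrow> ('a set \<Rightarrow> nat) \<Rightarrow> ('a set \<times> nat) set" where
  "weighted F w = (\<lambda>e. (e, w e)) ` F"

definition weighted_iso :: "('a set \<times> nat) set \<Rightarrow> ('b set \<times> nat) set \<Rightarrow> bool" where
  "weighted_iso A B \<longleftrightarrow>
     (\<exists>\<phi>. inj_on \<phi> (\<Union>(fst ` A)) \<and> B = (\<lambda>(e, k). (\<phi> ` e, k)) ` A)"

end

(* Let F be a set of edges of a Leech tree and m the least positive integer that is not a
   distance internal to F.  The path realising m leaves F, so some edge outside F has weight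
   at most m; conversely the weight of an edge outside F is not internal to F, because every
   distance occurs only once.  So the least weight outside F is exactly m, the mex of the
   internal distances.  Starting from F = {}, this forces the weights 1, 2, and then 4 or 3
   according to whether the first two edges meet; what remains is to see how the third edge
   can be attached without closing a triangle. *)
theory Submission
  imports Defs
begin

section \<open>Paths in graphs without cycles\<close>

lemma walk_edges_append:
  "walk_edges (xs @ z # ys) = walk_edges (xs @ [z]) @ walk_edges (z # ys)"
proof (induction xs)
  case (Cons x xs)
  then show ?case by (cases xs) auto
qed simp

lemma set_walk_edges_rev: "set (walk_edges (rev xs)) = set (walk_edges xs)"
proof (induction xs rule: walk_edges.induct)
  case (1 x y xs)
  have "walk_edges (rev (x # y # xs)) = walk_edges (rev (y # xs)) @ [{y, x}]"
    using walk_edges_append[of "rev xs" y "[x]"] by simp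
  with 1 show ?case by (auto simp: insert_commute)
qed simp_all

lemma length_walk_edges: "length (walk_edges p) = length p - 1"
  by (induction p rule: walk_edges.induct) auto

lemma walk_edge_subset: "e \<in> set (walk_edges p) \<Longrightarrow> e \<subseteq> set p"
  by (induction p rule: walk_edges.induct) auto

lemma distinct_walk_edges: "distinct p \<Longrightarrow> distinct (walk_edges p)"
proof (induction p rule: walk_edges.induct)
  case (1 x y xs)
  then show ?case using walk_edge_subset[of "{x, y}" "y # xs"] by auto
qed auto

text \<open>Follow \<open>p\<close> from \<open>x\<close> to its first vertex \<open>z\<close> on
  \<open>q\<close>, then return to \<open>x\<close> along \<open>q\<close>. Before \<open>z\<close>
  the first path avoids the second, so no vertex repeats.\<close>

lemma diverging_paths_cycle:
  assumes "distinct (x # p)" and "distinct (x # q)"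
    and "set (walk_edges (x # p)) \<subseteq> E" and "set (walk_edges (x # q)) \<subseteq> E"
    and "p \<noteq> []" and "q \<noteq> []" and "last p = last q" and "hd p \<noteq> hd q"
  shows "has_cycle E"
proof -
  have "\<exists>z\<in>set p. z \<in> set q"
    using assms(5-7) last_in_set by metis
  from split_list_first_prop[OF this]
  obtain p1 z p2 where p: "p = p1 @ z # p2" and z: "z \<in> set q"
    and p1: "\<forall>y\<in>set p1. y \<notin> set q"
    by blast
  from split_list[OF z] obtain q1 q2 where q: "q = q1 @ z # q2"
    by blast
  let ?c = "x # p1 @ z # rev q1"
  \<comment> \<open>If both were empty, \<open>z\<close> would be the head of \<open>p\<close> and
    of \<open>q\<close>. This gives the closed walk its third vertex.\<close>
  have "p1 \<noteq> [] \<or> q1 \<noteq> []"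
    using assms(8) p q by auto
  then have "3 \<le> length ?c" by (cases p1; cases q1) auto
  moreover have "distinct ?c"
    using assms(1,2) p1 unfolding p q by auto
  moreover have "set (walk_edges (?c @ [hd ?c])) \<subseteq> E"
  proof -
    have "walk_edges (?c @ [hd ?c])
        = walk_edges ((x # p1) @ [z]) @ walk_edges (rev ((x # q1) @ [z]))"
      using walk_edges_append[of "x # p1" z "rev q1 @ [x]"] by simp
    moreover have "set (walk_edges ((x # p1) @ [z])) \<subseteq> E"
      using assms(3) walk_edges_append[of "x # p1" z p2] unfolding p by simp
    moreover have "set (walk_edges ((x # q1) @ [z])) \<subseteq> E"
      using assms(4) walk_edges_append[of "x # q1" z q2] unfolding q by simp
    ultimately show ?thesis
      by (simp only: set_append set_walk_edges_rev) blast
  qed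
  ultimately show ?thesis unfolding has_cycle_def by blast
qed

text \<open>Common first steps are stripped off by induction; where the two paths first diverge, the
  previous lemma produces a cycle.\<close>

lemma path_between_unique:
  assumes "\<not> has_cycle E" and "path_between E x p y" and "path_between E x q y"
  shows "p = q"
  using assms(2,3)
proof (induction p arbitrary: x q)
  case Nil
  then show ?case by (simp add: path_between_def)
next
  case (Cons a p)
  obtain q' where q: "q = x # q'" and a: "a = x"
    using Cons.prems unfolding path_between_def by (cases q) auto
  show ?case
  proof (cases "p = [] \<or> q' = []")
    case True
    \<comment> \<open>One path is trivial, so \<open>x = y\<close>, and a path without repeated
      vertices cannot come back to its start.\<close>
    then show ?thesis using Cons.prems unfolding q a path_between_def
      by (metis distinct.simps(2) last_ConsL last_ConsR last_in_set)
  next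
    case False
    then obtain b r c s where pq: "p = b # r" "q' = c # s"
      by (meson neq_Nil_conv)
    show ?thesis
    proof (cases "b = c")
      case True
      have "path_between E b p y" "path_between E b q' y"
        using Cons.prems True unfolding q a pq path_between_def by auto
      then show ?thesis using Cons.IH q a by blast
    next
      case neq: False
      then have "has_cycle E"
        using Cons.prems False diverging_paths_cycle[of x p q' E]
        unfolding q a pq path_between_def by auto
      with assms(1) show ?thesis ..
    qed
  qed
qed

section \<open>Distances as sums along paths\<close>

lemma wdist_path:
  assumes "\<not> has_cycle E" and "path_between E x p y"
  shows "wdist E w x y = sum_list (map w (walk_edges p))"
  using the_equality[of "\<lambda>p. path_between E x p y", OF assms(2)]
    path_between_unique[OF assms(1) _ assms(2)]
  unfolding wdist_def by simp

lemma has_cycle_mono: "has_cycle F \<Longrightarrow> F \<subseteq> E \<Longrightarrow> has_cycle E"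
  unfolding has_cycle_def by blast

lemma internal_distances_acyclic:
  assumes "\<not> has_cycle F"
  shows "internal_distances F w =
    {sum_list (map w (walk_edges p)) | p. distinct p \<and> 2 \<le> length p \<and> set (walk_edges p) \<subseteq> F}"
    (is "_ = ?R")
proof (intro equalityI subsetI)
  fix d assume "d \<in> internal_distances F w"
  then obtain x y p where "x \<noteq> y" "path_between F x p y" and d: "d = wdist F w x y"
    unfolding internal_distances_def by blast
  moreover from this have "2 \<le> length p"
    unfolding path_between_def by (cases p rule: walk_edges.cases) auto
  ultimately show "d \<in> ?R"
    using wdist_path[OF assms, of x p y w] unfolding path_between_def by blast
next
  fix d assume "d \<in> ?R"
  then obtain p where p: "distinct p" "2 \<le> length p" "set (walk_edges p) \<subseteq> F"
    and d: "d = sum_list (map w (walk_edges p))" by blast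
  have "hd p \<noteq> last p"
    using p(1,2) by (cases p rule: walk_edges.cases) (auto dest: last_in_set)
  moreover have "path_between F (hd p) p (last p)"
    using p unfolding path_between_def by auto
  moreover from this have "d = wdist F w (hd p) (last p)"
    using d wdist_path[OF assms, of "hd p" p "last p" w] by simp
  ultimately show "d \<in> internal_distances F w"
    unfolding internal_distances_def by blast
qed

lemma short_list_cases:
  assumes "2 \<le> length p" and "length p \<le> 4"
  obtains x y where "p = [x, y]" | x y z where "p = [x, y, z]" | x y z t where "p = [x, y, z, t]"
proof -
  obtain x y r where p: "p = x # y # r"
    using assms(1) by (cases p rule: walk_edges.cases) auto
  show thesis
  proof (cases r rule: walk_edges.cases)
    case (1 z t s)
    then show ?thesis using that assms(2) p by auto
  qed (use that p in auto)
qed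

lemma card_2_other:
  assumes "card e = 2" and "x \<in> e"
  obtains y where "e = {x, y}" and "x \<noteq> y"
  using assms by (metis card_2_iff insertE insert_commute singletonD)

text \<open>A path uses each edge at most once, so here it has one, two or three edges. Such paths
  are described by which edges meet, with no reference to vertices; \<open>e \<inter> g = {}\<close>
  separates three consecutive edges from a star. All distance sets below are read off this
  formula.\<close>

lemma internal_distances_card_le_3:
  assumes "\<not> has_cycle F" and "\<forall>e\<in>F. card e = 2" and "finite F" and "card F \<le> 3"
  shows "internal_distances F w = w ` F
    \<union> (\<Union>e\<in>F. \<Union>f\<in>F. if e \<noteq> f \<and> e \<inter> f \<noteq> {} then {w e + w f} else {})
    \<union> (\<Union>e\<in>F. \<Union>f\<in>F. \<Union>g\<in>F.
         if e \<noteq> f \<and> e \<inter> f \<noteq> {} \<and> f \<noteq> g \<and> f \<inter> g \<noteq> {} \<and> e \<inter> g = {}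
         then {w e + w f + w g} else {})"
    (is "_ = ?A \<union> ?B \<union> ?C")
proof -
  have sub: "d \<in> ?A \<union> ?B \<union> ?C"
    if p: "distinct p" "2 \<le> length p" "set (walk_edges p) \<subseteq> F"
      and d: "d = sum_list (map w (walk_edges p))" for d p
  proof -
    \<comment> \<open>The edges of the path are distinct members of \<open>F\<close>.\<close>
    have "length p - 1 \<le> 3"
      using card_mono[OF assms(3) p(3)] distinct_card[OF distinct_walk_edges[OF p(1)]] assms(4)
      by (simp add: length_walk_edges)
    then have "length p \<le> 4" by simp
    with p(2) show ?thesis
    proof (cases rule: short_list_cases)
      case (1 x y)
      then show ?thesis using p d by auto
    next
      case (2 x y z)
      then have "d \<in> (if {x, y} \<noteq> {y, z} \<and> {x, y} \<inter> {y, z} \<noteq> {}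
          then {w {x, y} + w {y, z}} else {})"
        using p(1) d by (auto simp: doubleton_eq_iff)
      moreover have "{x, y} \<in> F" "{y, z} \<in> F" using p(3) 2 by auto
      ultimately show ?thesis by blast
    next
      case (3 x y z t)
      then have "d \<in> (if {x, y} \<noteq> {y, z} \<and> {x, y} \<inter> {y, z} \<noteq> {} \<and> {y, z} \<noteq> {z, t}
          \<and> {y, z} \<inter> {z, t} \<noteq> {} \<and> {x, y} \<inter> {z, t} = {}
          then {w {x, y} + w {y, z} + w {z, t}} else {})"
        using p(1) d by (auto simp: doubleton_eq_iff)
      moreover have "{x, y} \<in> F" "{y, z} \<in> F" "{z, t} \<in> F" using p(3) 3 by auto
      ultimately have "d \<in> ?C" by (intro UN_I)
      then show ?thesis by (rule UnI2)
    qed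
  qed
  have sup: "\<exists>p. d = sum_list (map w (walk_edges p))
      \<and> distinct p \<and> 2 \<le> length p \<and> set (walk_edges p) \<subseteq> F" if "d \<in> ?A \<union> ?B \<union> ?C" for d
    using that
  proof (elim UnE)
    assume "d \<in> ?A"
    then obtain e where e: "e \<in> F" "d = w e" by blast
    obtain x y where "e = {x, y}" "x \<noteq> y" using e(1) assms(2) by (meson card_2_iff)
    with e show ?thesis by (intro exI[of _ "[x, y]"]) simp
  next
    assume "d \<in> ?B"
    then obtain e f where ef: "e \<in> F" "f \<in> F" "e \<noteq> f" "e \<inter> f \<noteq> {}" "d = w e + w f"
      by (auto split: if_splits)
    obtain y where y: "y \<in> e" "y \<in> f" using ef(4) by blast
    obtain x where x: "e = {y, x}" "y \<noteq> x"
      using card_2_other ef(1) y(1) assms(2) by metis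
    obtain z where z: "f = {y, z}" "y \<noteq> z"
      using card_2_other ef(2) y(2) assms(2) by metis
    have "x \<noteq> z" using ef(3) x z by auto
    with ef x z show ?thesis by (intro exI[of _ "[x, y, z]"]) (simp add: insert_commute)
  next
    assume "d \<in> ?C"
    then obtain e f g where efg: "e \<in> F" "f \<in> F" "g \<in> F" "e \<inter> f \<noteq> {}" "f \<inter> g \<noteq> {}"
      "e \<inter> g = {}" "d = w e + w f + w g"
      by (auto split: if_splits)
    obtain y z where y: "y \<in> e" "y \<in> f" and z: "z \<in> f" "z \<in> g"
      using efg(4,5) by blast
    \<comment> \<open>A common value would lie in both end edges, which are disjoint; so the middle
      edge is exactly \<open>{y, z}\<close>.\<close>
    have yz: "y \<noteq> z" using y z efg(6) by blast
    have f: "f = {y, z}"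
      using card_2_other[of f y] y(2) z(1) yz efg(2) assms(2) by (metis insertE singletonD)
    obtain x where x: "e = {y, x}" "y \<noteq> x"
      using card_2_other efg(1) y(1) assms(2) by metis
    obtain t where t: "g = {z, t}" "z \<noteq> t"
      using card_2_other efg(3) z(2) assms(2) by metis
    show ?thesis using efg x yz f t
      by (intro exI[of _ "[x, y, z, t]"]) (auto simp: insert_commute)
  qed
  show ?thesis
    unfolding internal_distances_acyclic[OF assms(1)]
  proof (intro equalityI subsetI CollectI)
    fix d assume "d \<in> {sum_list (map w (walk_edges p)) | p.
      distinct p \<and> 2 \<le> length p \<and> set (walk_edges p) \<subseteq> F}"
    then show "d \<in> ?A \<union> ?B \<union> ?C" by (elim CollectE exE conjE) (rule sub)
  qed (rule sup)
qed

section \<open>Forests with at most three edges\<close>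

lemma internal_distances_empty: "internal_distances {} w = {}"
proof -
  have "\<not> has_cycle ({} :: 'a set set)"
    unfolding has_cycle_def by (auto simp: Suc_le_length_iff numeral_3_eq_3)
  then show ?thesis by (simp add: internal_distances_card_le_3)
qed

lemma internal_distances_edge:
  assumes "\<not> has_cycle {e}" and "card e = 2"
  shows "internal_distances {e} w = {w e}"
  using assms by (simp add: internal_distances_card_le_3)

lemma internal_distances_two_meeting:
  assumes "\<not> has_cycle {e, f}" and "card e = 2" "card f = 2" and "e \<noteq> f" "e \<inter> f \<noteq> {}"
  shows "internal_distances {e, f} w = {w e, w f, w e + w f}"
proof -
  have "f \<inter> e \<noteq> {}" using assms(5) by blast
  with assms show ?thesis
    by (subst internal_distances_card_le_3) (auto simp: card_insert_if)
qed

lemma internal_distances_matching: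
  assumes "\<not> has_cycle F" and "\<forall>e\<in>F. card e = 2" and "finite F" and "card F \<le> 3"
    and "\<forall>e\<in>F. \<forall>f\<in>F. e \<noteq> f \<longrightarrow> e \<inter> f = {}"
  shows "internal_distances F w = w ` F"
  using assms(5) unfolding internal_distances_card_le_3[OF assms(1-4)]
  by (auto split: if_splits)

lemma
  assumes "\<not> has_cycle {e, f, g}" and "card e = 2" "card f = 2" "card g = 2"
    and "e \<noteq> f" "f \<noteq> g" "e \<noteq> g"
  shows internal_distances_path_edge:
      "\<lbrakk>e \<inter> f \<noteq> {}; f \<inter> g = {}; e \<inter> g = {}\<rbrakk> \<Longrightarrow>
       internal_distances {e, f, g} w = {w e, w f, w g, w e + w f}"
    and internal_distances_path:
      "\<lbrakk>e \<inter> f \<noteq> {}; f \<inter> g \<noteq> {}; e \<inter> g = {}\<rbrakk> \<Longrightarrow>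
       internal_distances {e, f, g} w =
         {w e, w f, w g, w e + w f, w f + w g, w e + w f + w g}"
    and internal_distances_star:
      "\<lbrakk>e \<inter> f \<noteq> {}; f \<inter> g \<noteq> {}; e \<inter> g \<noteq> {}\<rbrakk> \<Longrightarrow>
       internal_distances {e, f, g} w =
         {w e, w f, w g, w e + w f, w f + w g, w e + w g}"
proof -
  note neq = assms(5-7) assms(5-7)[symmetric]
  have eq: "internal_distances {e, f, g} w = w ` {e, f, g}
    \<union> (\<Union>a\<in>{e, f, g}. \<Union>b\<in>{e, f, g}. if a \<noteq> b \<and> a \<inter> b \<noteq> {} then {w a + w b} else {})
    \<union> (\<Union>a\<in>{e, f, g}. \<Union>b\<in>{e, f, g}. \<Union>c\<in>{e, f, g}.
         if a \<noteq> b \<and> a \<inter> b \<noteq> {} \<and> b \<noteq> c \<and> b \<inter> c \<noteq> {} \<and> a \<inter> c = {}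
         then {w a + w b + w c} else {})"
    using assms by (intro internal_distances_card_le_3) auto
  \<comment> \<open>Triples with \<open>a = c\<close> go back and forth along one edge; nonemptiness
    of that edge refutes their condition \<open>a \<inter> c = {}\<close>.\<close>
  have nonempty: "e \<noteq> {}" "f \<noteq> {}" "g \<noteq> {}" using assms(2-4) by auto
  \<comment> \<open>The unions run over ordered pairs and triples, so each intersection occurs in
    both orders; these equations turn them to the order of the case hypotheses.\<close>
  have comm: "f \<inter> e = e \<inter> f" "g \<inter> f = f \<inter> g" "g \<inter> e = e \<inter> g" by blast+
  show "internal_distances {e, f, g} w = {w e, w f, w g, w e + w f}"
    if "e \<inter> f \<noteq> {}" "f \<inter> g = {}" "e \<inter> g = {}"
    unfolding eq by (simp add: that neq comm nonempty add_ac insert_commute)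
  show "internal_distances {e, f, g} w =
      {w e, w f, w g, w e + w f, w f + w g, w e + w f + w g}"
    if "e \<inter> f \<noteq> {}" "f \<inter> g \<noteq> {}" "e \<inter> g = {}"
    unfolding eq by (simp add: that neq comm nonempty add_ac insert_commute)
  show "internal_distances {e, f, g} w =
      {w e, w f, w g, w e + w f, w f + w g, w e + w g}"
    if "e \<inter> f \<noteq> {}" "f \<inter> g \<noteq> {}" "e \<inter> g \<noteq> {}"
    unfolding eq by (simp add: that neq comm nonempty add_ac insert_commute)
qed

section \<open>Isomorphism types from intersection patterns\<close>

lemma distinct_lists_bijection:
  assumes "distinct xs" and "distinct ys" and "length xs = length ys"
  obtains \<phi> where "inj_on \<phi> (set xs)" and "map \<phi> xs = ys"
proof
  let ?\<phi> = "the \<circ> map_of (zip xs ys)"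
  show eq: "map ?\<phi> xs = ys"
    using assms by (intro nth_equalityI) (simp_all add: map_of_zip_nth)
  then show "inj_on ?\<phi> (set xs)"
    using assms(2) distinct_map by metis
qed

text \<open>In each shape the vertices are listed in the order of the template, shown to be distinct
  from the intersection pattern, and renamed entry by entry. The star asks for a vertex common to
  all three edges, since pairwise meeting would also allow a triangle.\<close>

lemma
  assumes "card e = 2" "card f = 2" "card g = 2" and "e \<noteq> f" "f \<noteq> g" "e \<noteq> g"
  shows weighted_iso_matching:
      "\<lbrakk>e \<inter> f = {}; f \<inter> g = {}; e \<inter> g = {}; distinct [a', b', c', d', e', f']\<rbrakk> \<Longrightarrow>
       weighted_iso {(e, i), (f, j), (g, k)} {({a', b'}, i), ({c', d'}, j), ({e', f'}, k)}"
    and weighted_iso_path_edge: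
      "\<lbrakk>e \<inter> f \<noteq> {}; f \<inter> g = {}; e \<inter> g = {}; distinct [a', b', c', d', e']\<rbrakk> \<Longrightarrow>
       weighted_iso {(e, i), (f, j), (g, k)} {({a', b'}, i), ({b', c'}, j), ({d', e'}, k)}"
    and weighted_iso_path:
      "\<lbrakk>e \<inter> f \<noteq> {}; f \<inter> g \<noteq> {}; e \<inter> g = {}; distinct [a', b', c', d']\<rbrakk> \<Longrightarrow>
       weighted_iso {(e, i), (f, j), (g, k)} {({a', b'}, i), ({b', c'}, j), ({c', d'}, k)}"
    and weighted_iso_star:
      "\<lbrakk>e \<inter> f \<inter> g \<noteq> {}; distinct [a', b', c', d']\<rbrakk> \<Longrightarrow>
       weighted_iso {(e, i), (f, j), (g, k)} {({a', b'}, i), ({a', c'}, j), ({a', d'}, k)}"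
proof -
  show "weighted_iso {(e, i), (f, j), (g, k)} {({a', b'}, i), ({c', d'}, j), ({e', f'}, k)}"
    if disj: "e \<inter> f = {}" "f \<inter> g = {}" "e \<inter> g = {}" and d': "distinct [a', b', c', d', e', f']"
  proof -
    obtain x1 x2 x3 x4 x5 x6 where "e = {x1, x2}" "f = {x3, x4}" "g = {x5, x6}"
      and "x1 \<noteq> x2" "x3 \<noteq> x4" "x5 \<noteq> x6"
      using assms(1-3) by (metis card_2_iff)
    moreover from this have "distinct [x1, x2, x3, x4, x5, x6]" using disj by auto
    then obtain \<phi> where "inj_on \<phi> (set [x1, x2, x3, x4, x5, x6])"
      and "map \<phi> [x1, x2, x3, x4, x5, x6] = [a', b', c', d', e', f']"
      by (rule distinct_lists_bijection[OF _ d']) simp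
    ultimately show ?thesis
      unfolding weighted_iso_def
      by (intro exI[of _ \<phi>]) (simp add: insert_commute del: inj_on_insert)
  qed
  show "weighted_iso {(e, i), (f, j), (g, k)} {({a', b'}, i), ({b', c'}, j), ({d', e'}, k)}"
    if meet: "e \<inter> f \<noteq> {}" "f \<inter> g = {}" "e \<inter> g = {}" and d': "distinct [a', b', c', d', e']"
  proof -
    obtain x2 where "x2 \<in> e" "x2 \<in> f" using meet(1) by blast
    then obtain x1 x3 x4 x5 where "e = {x2, x1}" "f = {x2, x3}" "g = {x4, x5}"
      and "x2 \<noteq> x1" "x2 \<noteq> x3" "x4 \<noteq> x5"
      using assms(1-3) card_2_other by (metis card_2_iff)
    moreover from this have "distinct [x1, x2, x3, x4, x5]" using assms(4) meet by auto
    then obtain \<phi> where "inj_on \<phi> (set [x1, x2, x3, x4, x5])"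
      and "map \<phi> [x1, x2, x3, x4, x5] = [a', b', c', d', e']"
      by (rule distinct_lists_bijection[OF _ d']) simp
    ultimately show ?thesis
      unfolding weighted_iso_def
      by (intro exI[of _ \<phi>]) (simp add: insert_commute del: inj_on_insert)
  qed
  show "weighted_iso {(e, i), (f, j), (g, k)} {({a', b'}, i), ({b', c'}, j), ({c', d'}, k)}"
    if meet: "e \<inter> f \<noteq> {}" "f \<inter> g \<noteq> {}" "e \<inter> g = {}" and d': "distinct [a', b', c', d']"
  proof -
    obtain x2 x3 where x: "x2 \<in> e" "x2 \<in> f" "x3 \<in> f" "x3 \<in> g" using meet(1,2) by blast
    have "x2 \<noteq> x3" using x meet(3) by blast
    moreover from this have "f = {x2, x3}"
      using card_2_other[OF assms(2) x(2)] x(3) by blast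
    moreover obtain x1 x4 where "e = {x2, x1}" "g = {x3, x4}" "x2 \<noteq> x1" "x3 \<noteq> x4"
      using assms(1,3) x card_2_other by metis
    moreover from calculation have "distinct [x1, x2, x3, x4]" using meet by auto
    then obtain \<phi> where "inj_on \<phi> (set [x1, x2, x3, x4])"
      and "map \<phi> [x1, x2, x3, x4] = [a', b', c', d']"
      by (rule distinct_lists_bijection[OF _ d']) simp
    ultimately show ?thesis
      unfolding weighted_iso_def
      by (intro exI[of _ \<phi>]) (simp add: insert_commute del: inj_on_insert)
  qed
  show "weighted_iso {(e, i), (f, j), (g, k)} {({a', b'}, i), ({a', c'}, j), ({a', d'}, k)}"
    if meet: "e \<inter> f \<inter> g \<noteq> {}" and d': "distinct [a', b', c', d']"
  proof -
    obtain x where "x \<in> e" "x \<in> f" "x \<in> g" using meet by blast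
    then obtain x1 x2 x3 where "e = {x, x1}" "f = {x, x2}" "g = {x, x3}"
      and "x \<noteq> x1" "x \<noteq> x2" "x \<noteq> x3"
      using assms(1-3) card_2_other by metis
    moreover from this have "distinct [x, x1, x2, x3]" using assms(4-6) by auto
    then obtain \<phi> where "inj_on \<phi> (set [x, x1, x2, x3])"
      and "map \<phi> [x, x1, x2, x3] = [a', b', c', d']"
      by (rule distinct_lists_bijection[OF _ d']) simp
    ultimately show ?thesis
      unfolding weighted_iso_def
      by (intro exI[of _ \<phi>]) (simp add: insert_commute del: inj_on_insert)
  qed
qed

text \<open>Without a common vertex the three pairwise meeting points are distinct, and the edges
  form the triangle on them.\<close>

lemma pairwise_meeting_edges_star:
  assumes "\<not> has_cycle {e, f, g}" and "card e = 2" "card f = 2" "card g = 2"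
    and "e \<inter> f \<noteq> {}" "f \<inter> g \<noteq> {}" "e \<inter> g \<noteq> {}"
  shows "e \<inter> f \<inter> g \<noteq> {}"
proof
  assume none: "e \<inter> f \<inter> g = {}"
  obtain x y z where x: "x \<in> e" "x \<in> f" and y: "y \<in> f" "y \<in> g" and z: "z \<in> e" "z \<in> g"
    using assms(5-7) by blast
  have neq: "x \<noteq> y" "y \<noteq> z" "x \<noteq> z" using x y z none by blast+
  have "f = {x, y}" using card_2_other[OF assms(3) x(2)] y(1) neq by blast
  moreover have "g = {y, z}" using card_2_other[OF assms(4) y(2)] z(2) neq by blast
  moreover have "e = {z, x}" using card_2_other[OF assms(2) z(1)] x(1) neq by blast
  ultimately have "has_cycle {e, f, g}"
    using neq unfolding has_cycle_def by (intro exI[of _ "[x, y, z]"]) auto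
  with assms(1) show False ..
qed

section \<open>Edges of small weight in a Leech tree\<close>

lemma walk_vertex_in_edge:
  "2 \<le> length p \<Longrightarrow> z \<in> set p \<Longrightarrow> \<exists>e\<in>set (walk_edges p). z \<in> e"
proof (induction p rule: walk_edges.induct)
  case (1 x y xs)
  then show ?case by (cases xs) auto
qed auto

text \<open>A path of \<open>F\<close> is also the only path of \<open>E\<close> between its ends,
  so the distance in the forest is the distance in the tree.\<close>

lemma internal_distance_in_tree:
  assumes "tree_graph V E" and "F \<subseteq> E" and "d \<in> internal_distances F w"
  obtains x y p where "x \<in> V" "y \<in> V" "x \<noteq> y" "path_between F x p y" "wdist E w x y = d"
proof -
  have nc: "\<not> has_cycle E" and simple: "\<forall>e\<in>E. e \<subseteq> V"
    using assms(1) unfolding tree_graph_def simple_graph_def by auto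
  obtain x y p where xy: "x \<noteq> y" and p: "path_between F x p y" and d: "d = wdist F w x y"
    using assms(3) unfolding internal_distances_def by blast
  have pE: "path_between E x p y" using p assms(2) unfolding path_between_def by blast
  have "wdist E w x y = d"
    using wdist_path[OF nc pE, of w] wdist_path[OF _ p, of w] nc has_cycle_mono[OF _ assms(2)] d
    by metis
  \<comment> \<open>\<open>path_between\<close> alone does not place the ends in \<open>V\<close>,
    as \<open>[x]\<close> is a path for every \<open>x\<close>. A nontrivial path has all its
    vertices on edges, hence in \<open>V\<close>.\<close>
  moreover have "2 \<le> length p"
    using p xy unfolding path_between_def by (cases p rule: walk_edges.cases) auto
  then have "set p \<subseteq> V"
    using walk_vertex_in_edge[of p] pE simple unfolding path_between_def by blast
  then have "x \<in> V" "y \<in> V"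
    using p unfolding path_between_def by auto
  ultimately show thesis using that xy p by blast
qed

text \<open>This is the mex principle: \<open>D\<close> and \<open>1 \<le> m\<close> make
  \<open>m\<close> the least positive integer that is not internal to \<open>F\<close>, and the
  upper bound on \<open>m\<close> guarantees that some pair of vertices realises it.\<close>

lemma leech_next_edge:
  assumes L: "leech_tree V E w" and "F \<subseteq> E"
    and D: "{1..<m} \<subseteq> internal_distances F w" "m \<notin> internal_distances F w"
    and m: "1 \<le> m" "m \<le> card V choose 2"
  shows "(\<exists>e\<in>E - F. w e = m) \<and> (\<forall>f\<in>E - F. m \<le> w f)"
proof -
  have tree: "tree_graph V E" and pos: "\<forall>e\<in>E. 0 < w e"
    and range: "\<forall>x\<in>V. \<forall>y\<in>V. x \<noteq> y \<longrightarrow> wdist E w x y \<in> {1..card V choose 2}"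
    and unique: "\<forall>k\<in>{1..card V choose 2}.
        \<exists>!P. \<exists>x\<in>V. \<exists>y\<in>V. x \<noteq> y \<and> P = {x, y} \<and> wdist E w x y = k"
    using L unfolding leech_tree_def by auto
  have nc: "\<not> has_cycle E" and simple: "\<forall>e\<in>E. e \<subseteq> V \<and> card e = 2"
    and conn: "\<forall>x\<in>V. \<forall>y\<in>V. \<exists>p. path_between E x p y"
    using tree unfolding tree_graph_def simple_graph_def connected_graph_def by auto
  have lower: "m \<le> w f" if f: "f \<in> E - F" for f
  proof (rule ccontr)
    assume "\<not> m \<le> w f"
    then have "w f \<in> internal_distances F w" using D(1) pos f by fastforce
    then obtain u v p where uv: "u \<in> V" "v \<in> V" "u \<noteq> v" and p: "path_between F u p v"
      and duv: "wdist E w u v = w f"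
      by (rule internal_distance_in_tree[OF tree assms(2)])
    obtain x y where xy: "f = {x, y}" "x \<noteq> y" using simple f by (meson DiffD1 card_2_iff)
    then have "path_between E x [x, y] y" using f unfolding path_between_def by auto
    from wdist_path[OF nc this] have dxy: "wdist E w x y = w f" using xy by simp
    have "w f \<in> {1..card V choose 2}" using range uv duv by metis
    from bspec[OF unique this]
    have "\<exists>!P. \<exists>x\<in>V. \<exists>y\<in>V. x \<noteq> y \<and> P = {x, y} \<and> wdist E w x y = w f" .
    moreover have "x \<in> V" "y \<in> V" using simple f xy(1) by auto
    \<comment> \<open>Both pairs realise the distance \<open>w f\<close>, which occurs only
      once.\<close>
    ultimately have "{u, v} = f" using uv duv xy dxy by blast
    then have "path_between E u [u, v] v" using f uv unfolding path_between_def by auto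
    moreover have "path_between E u p v" using p assms(2) unfolding path_between_def by blast
    \<comment> \<open>The path inside \<open>F\<close> must be the single edge \<open>f\<close>,
      although \<open>f\<close> lies outside \<open>F\<close>.\<close>
    ultimately have "p = [u, v]" using path_between_unique[OF nc] by blast
    then show False using p f \<open>{u, v} = f\<close> unfolding path_between_def by auto
  qed
  have "m \<in> {1..card V choose 2}" using m by simp
  then obtain x y where xy: "x \<in> V" "y \<in> V" "x \<noteq> y" and d: "wdist E w x y = m"
    using unique by (metis (no_types, lifting))
  obtain p where p: "path_between E x p y" using conn xy by blast
  have sum: "sum_list (map w (walk_edges p)) = m" using wdist_path[OF nc p] d by simp
  have "\<not> set (walk_edges p) \<subseteq> F"
  proof
    assume "set (walk_edges p) \<subseteq> F"
    then have pF: "path_between F x p y" using p unfolding path_between_def by blast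
    then have "wdist F w x y = m"
      using wdist_path[OF _ pF, of w] nc has_cycle_mono[OF _ assms(2)] sum by metis
    then show False using D(2) xy(3) pF unfolding internal_distances_def by blast
  qed
  then obtain e where e: "e \<in> set (walk_edges p)" "e \<in> E - F"
    using p unfolding path_between_def by blast
  \<comment> \<open>An edge weighs no more than the whole path; with the lower bound its weight is
    exactly \<open>m\<close>.\<close>
  have "w e \<le> m" using member_le_sum_list[of "w e" "map w (walk_edges p)"] e(1) sum by simp
  with e(2) lower show ?thesis by (metis le_antisym)
qed

section \<open>Recognising the lightest edges\<close>

lemma lightest_edges_eqI:
  assumes "finite E" and "F \<subseteq> E" and "\<And>f e. f \<in> F \<Longrightarrow> e \<in> E - F \<Longrightarrow> w f < w e"
  shows "lightest_edges (card F) E w = F"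
proof -
  have "card {f \<in> E. w f < w e} < card F" if "e \<in> F" for e
  proof (rule psubset_card_mono)
    show "finite F" using assms(1,2) finite_subset by blast
    have "f \<in> F" if "f \<in> E" "w f < w e" for f
      using assms(3)[OF \<open>e \<in> F\<close>, of f] that by force
    \<comment> \<open>The inclusion is strict because \<open>e\<close> is not lighter than
      itself.\<close>
    then show "{f \<in> E. w f < w e} \<subset> F" using \<open>e \<in> F\<close> by blast
  qed
  moreover have "\<not> card {f \<in> E. w f < w e} < card F" if "e \<in> E - F" for e
  proof -
    have "F \<subseteq> {f \<in> E. w f < w e}" using assms(2,3) that by blast
    then show ?thesis using card_mono[of "{f \<in> E. w f < w e}" F] assms(1) by force
  qed
  ultimately show ?thesis using assms(2) unfolding lightest_edges_def by blast
qed

text \<open>The mex \<open>q\<close> separates the weights: those in \<open>F\<close> lie below it,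
  those outside are at least \<open>q\<close>, and \<open>q\<close> itself is attained
  outside.\<close>

lemma leech_lightest_edges:
  assumes "leech_tree V E w" and "F \<subseteq> E"
    and "{1..<q} \<subseteq> internal_distances F w" "q \<notin> internal_distances F w"
    and "1 \<le> q" "q \<le> card V choose 2" and "\<forall>f\<in>F. w f < q"
  shows "lightest_edges (card F) E w = F" and "Min (w ` (E - F)) = q"
proof -
  have "finite V" "E \<subseteq> Pow V"
    using assms(1) unfolding leech_tree_def tree_graph_def simple_graph_def by auto
  then have fin: "finite E" by (simp add: finite_subset)
  obtain e where e: "e \<in> E - F" "w e = q" and le: "\<forall>f\<in>E - F. q \<le> w f"
    using leech_next_edge[OF assms(1-6)] by blast
  show "lightest_edges (card F) E w = F"
    using le assms(7) by (intro lightest_edges_eqI[OF fin assms(2)]) force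
  show "Min (w ` (E - F)) = q"
    using e le fin by (intro Min_eqI) auto
qed

section \<open>The eight forms and the place of the third edge\<close>

lemma leech_tree_card_edge: "leech_tree V E w \<Longrightarrow> e \<in> E \<Longrightarrow> card e = 2"
  unfolding leech_tree_def tree_graph_def simple_graph_def by blast

lemma leech_tree_acyclic: "leech_tree V E w \<Longrightarrow> F \<subseteq> E \<Longrightarrow> \<not> has_cycle F"
  using has_cycle_mono unfolding leech_tree_def tree_graph_def by blast

text \<open>In every triple the last entry is the mex of the middle one. In the first four forms the
  edges of weights 1 and 2 meet, in the last four they are disjoint.\<close>

definition three_edge_forms :: "((nat set \<times> nat) set \<times> nat set \<times> nat) set" where
  "three_edge_forms =
    {({({0,1}, 1), ({1,2}, 2), ({3,4}, 4)}, {1,2,3,4},     5),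
     ({({0,1}, 4), ({1,2}, 1), ({2,3}, 2)}, {1,2,3,4,5,7}, 6),
     ({({0,1}, 1), ({1,2}, 2), ({2,3}, 4)}, {1,2,3,4,6,7}, 5),
     ({({0,1}, 1), ({0,2}, 2), ({0,3}, 4)}, {1,2,3,4,5,6}, 7),
     ({({0,1}, 1), ({2,3}, 2), ({4,5}, 3)}, {1,2,3},       4),
     ({({0,1}, 1), ({1,2}, 3), ({3,4}, 2)}, {1,2,3,4},     5),
     ({({0,1}, 1), ({2,3}, 2), ({3,4}, 3)}, {1,2,3,5},     4),
     ({({0,1}, 1), ({1,2}, 3), ({2,3}, 2)}, {1,2,3,4,5,6}, 7)}"

text \<open>The common end of all eight cases. The values 3 and 4 keep \<open>e3\<close> apart from
  \<open>e1\<close> and \<open>e2\<close>; with \<open>w e3 < q\<close> all three weights lie below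
  \<open>q\<close>, and \<open>q \<le> 10\<close> puts \<open>q\<close> in the range of realised
  distances.\<close>

lemma leech_form:
  assumes "leech_tree V E w" and C: "10 \<le> card V choose 2"
    and e1: "e1 \<in> E" "w e1 = 1" and e2: "e2 \<in> E" "w e2 = 2"
    and "(S, D, q) \<in> three_edge_forms" and "e3 \<in> E" and "w e3 \<in> {3, 4}" and "w e3 < q"
    and "weighted_iso (weighted {e1, e2, e3} w) S" and "internal_distances {e1, e2, e3} w = D"
    and "{1..<q} \<subseteq> D" and "q \<notin> D" and "q \<le> 10"
  shows "\<exists>(S, D, q)\<in>three_edge_forms. weighted_iso (weighted (lightest_edges 3 E w) w) S
    \<and> internal_distances (lightest_edges 3 E w) w = D \<and> Min (w ` (E - lightest_edges 3 E w)) = q"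
proof -
  let ?F = "{e1, e2, e3}"
  have "e1 \<noteq> e2" "e2 \<noteq> e3" "e1 \<noteq> e3" using e1 e2 assms(9) by auto
  then have "card ?F = 3" by simp
  moreover have prems: "?F \<subseteq> E" "{1..<q} \<subseteq> internal_distances ?F w"
    "q \<notin> internal_distances ?F w" "1 \<le> q" "q \<le> card V choose 2" "\<forall>f\<in>?F. w f < q"
    using assms(8-10,12-15) e1 e2 C by auto
  moreover note leech_lightest_edges[OF assms(1) prems]
  ultimately have "lightest_edges 3 E w = ?F" "Min (w ` (E - ?F)) = q" by simp_all
  then show ?thesis using assms(11,12) by (intro bexI[OF _ assms(7)]) simp
qed

text \<open>Two meeting edges of weights 1 and 2 already realise 3, so the third weight is 4. The
  cases are the ways in which \<open>e3\<close> can meet \<open>e1\<close> and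
  \<open>e2\<close>.\<close>

lemma leech_form_meeting:
  assumes "leech_tree V E w" and C: "10 \<le> card V choose 2"
    and e1: "e1 \<in> E" "w e1 = 1" and e2: "e2 \<in> E" "w e2 = 2"
    and meet: "e1 \<inter> e2 \<noteq> {}"
  shows "\<exists>(S, D, q)\<in>three_edge_forms. weighted_iso (weighted (lightest_edges 3 E w) w) S
    \<and> internal_distances (lightest_edges 3 E w) w = D \<and> Min (w ` (E - lightest_edges 3 E w)) = q"
proof -
  note edge = leech_tree_card_edge[OF assms(1)] and nc_sub = leech_tree_acyclic[OF assms(1)]
  have neq12: "e1 \<noteq> e2" using e1 e2 by auto
  have "internal_distances {e1, e2} w = {1, 2, 3}"
    using internal_distances_two_meeting[OF nc_sub edge edge _ meet, where w = w] e1 e2 neq12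
    by (simp del: One_nat_def)
  moreover have "{1..<4} \<subseteq> {1, 2, 3 :: nat}" by auto
  ultimately obtain e3 where e3: "e3 \<in> E" "w e3 = 4"
    using leech_next_edge[OF assms(1), of "{e1, e2}" 4] e1(1) e2(1) C by auto
  have neq: "e1 \<noteq> e2" "e2 \<noteq> e3" "e1 \<noteq> e3" "e2 \<noteq> e1" "e3 \<noteq> e2" "e3 \<noteq> e1"
    using e1 e2 e3 by auto
  have acyclic: "\<not> has_cycle {e1, e2, e3}" "\<not> has_cycle {e3, e1, e2}"
    using nc_sub e1 e2 e3 by simp_all
  note edges = edge[OF e1(1)] edge[OF e2(1)] edge[OF e3(1)]
  note weights = e1(2) e2(2) e3(2)
  have W: "weighted {e1, e2, e3} w = {(e1, 1), (e2, 2), (e3, 4)}"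
    using weights by (simp add: weighted_def)
  \<comment> \<open>Each intersection is written in the order in which its edges are passed to the
    shape lemmas.\<close>
  consider "e2 \<inter> e3 = {}" "e1 \<inter> e3 = {}" | "e3 \<inter> e2 = {}" "e3 \<inter> e1 \<noteq> {}"
    | "e2 \<inter> e3 \<noteq> {}" "e1 \<inter> e3 = {}" | "e2 \<inter> e3 \<noteq> {}" "e1 \<inter> e3 \<noteq> {}"
    by blast
  then show ?thesis
  proof cases
    case 1
    have iso: "weighted_iso (weighted {e1, e2, e3} w) {({0::nat,1}, 1), ({1,2}, 2), ({3,4}, 4)}"
      unfolding W by (intro weighted_iso_path_edge[OF edges neq(1-3) meet 1]) simp
    have dist: "internal_distances {e1, e2, e3} w = {1,2,3,4}"
      using internal_distances_path_edge[OF acyclic(1) edges neq(1-3) meet 1] weights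
      by (auto simp del: One_nat_def)
    show ?thesis
      by (rule leech_form[where q = 5, OF assms(1) C e1 e2 _ e3(1) _ _ iso dist])
         (simp_all add: three_edge_forms_def e3(2), auto)
  next
    case 2
    \<comment> \<open>The edge of weight 1 is the middle of the path, so the edges are taken in the
      order \<open>e3\<close>, \<open>e1\<close>, \<open>e2\<close> and permuted back
      afterwards.\<close>
    have "weighted_iso {(e3, 4), (e1, 1), (e2, 2)} {({0::nat,1}, 4), ({1,2}, 1), ({2,3}, 2)}"
      by (intro weighted_iso_path[OF edges(3,1,2) neq(6,1,5) 2(2) meet 2(1)]) simp
    then have iso: "weighted_iso (weighted {e1, e2, e3} w) {({0::nat,1}, 4), ({1,2}, 1), ({2,3}, 2)}"
      unfolding W by (simp add: insert_commute)
    have "internal_distances {e3, e1, e2} w = {1,2,3,4,5,7}"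
      using internal_distances_path[OF acyclic(2) edges(3,1,2) neq(6,1,5) 2(2) meet 2(1)] weights
      by (auto simp del: One_nat_def)
    then have dist: "internal_distances {e1, e2, e3} w = {1,2,3,4,5,7}"
      by (simp add: insert_commute)
    show ?thesis
      by (rule leech_form[where q = 6, OF assms(1) C e1 e2 _ e3(1) _ _ iso dist])
         (simp_all add: three_edge_forms_def e3(2), auto)
  next
    case 3
    have iso: "weighted_iso (weighted {e1, e2, e3} w) {({0::nat,1}, 1), ({1,2}, 2), ({2,3}, 4)}"
      unfolding W by (intro weighted_iso_path[OF edges neq(1-3) meet 3]) simp
    have dist: "internal_distances {e1, e2, e3} w = {1,2,3,4,6,7}"
      using internal_distances_path[OF acyclic(1) edges neq(1-3) meet 3] weights
      by (auto simp del: One_nat_def)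
    show ?thesis
      by (rule leech_form[where q = 5, OF assms(1) C e1 e2 _ e3(1) _ _ iso dist])
         (simp_all add: three_edge_forms_def e3(2), auto)
  next
    case 4
    \<comment> \<open>Acyclicity excludes the triangle, leaving the star.\<close>
    have "e1 \<inter> e2 \<inter> e3 \<noteq> {}"
      using pairwise_meeting_edges_star[OF acyclic(1) edges meet 4] .
    then have iso: "weighted_iso (weighted {e1, e2, e3} w)
        {({0::nat,1}, 1), ({0,2}, 2), ({0,3}, 4)}"
      unfolding W by (intro weighted_iso_star[OF edges neq(1-3)]) simp_all
    have dist: "internal_distances {e1, e2, e3} w = {1,2,3,4,5,6}"
      using internal_distances_star[OF acyclic(1) edges neq(1-3) meet 4] weights
      by (auto simp del: One_nat_def)
    show ?thesis
      by (rule leech_form[where q = 7, OF assms(1) C e1 e2 _ e3(1) _ _ iso dist])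
         (simp_all add: three_edge_forms_def e3(2), auto)
  qed
qed

text \<open>Two disjoint edges realise only 1 and 2, so the third weight is 3. No star can arise; an
  \<open>e3\<close> that meets both edges joins them to a path with \<open>e3\<close> in the
  middle.\<close>

lemma leech_form_disjoint:
  assumes "leech_tree V E w" and C: "10 \<le> card V choose 2"
    and e1: "e1 \<in> E" "w e1 = 1" and e2: "e2 \<in> E" "w e2 = 2"
    and disj: "e1 \<inter> e2 = {}"
  shows "\<exists>(S, D, q)\<in>three_edge_forms. weighted_iso (weighted (lightest_edges 3 E w) w) S
    \<and> internal_distances (lightest_edges 3 E w) w = D \<and> Min (w ` (E - lightest_edges 3 E w)) = q"
proof -
  note edge = leech_tree_card_edge[OF assms(1)] and nc_sub = leech_tree_acyclic[OF assms(1)]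
  have "internal_distances {e1, e2} w = w ` {e1, e2}"
    using nc_sub[of "{e1, e2}"] edge e1 e2 disj
    by (intro internal_distances_matching) (auto simp: card_insert_if)
  then have "internal_distances {e1, e2} w = {1, 2}" using e1 e2 by simp
  moreover have "{1..<3} \<subseteq> {1, 2 :: nat}" by auto
  ultimately obtain e3 where e3: "e3 \<in> E" "w e3 = 3"
    using leech_next_edge[OF assms(1), of "{e1, e2}" 3] e1(1) e2(1) C by auto
  have neq: "e1 \<noteq> e2" "e2 \<noteq> e3" "e1 \<noteq> e3" "e2 \<noteq> e1" "e3 \<noteq> e2" "e3 \<noteq> e1"
    using e1 e2 e3 by auto
  have acyclic: "\<not> has_cycle {e1, e2, e3}" "\<not> has_cycle {e1, e3, e2}"
    "\<not> has_cycle {e2, e3, e1}"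
    using nc_sub e1 e2 e3 by simp_all
  note edges = edge[OF e1(1)] edge[OF e2(1)] edge[OF e3(1)]
  note weights = e1(2) e2(2) e3(2)
  have W: "weighted {e1, e2, e3} w = {(e1, 1), (e2, 2), (e3, 3)}"
    using weights by (simp add: weighted_def)
  consider "e2 \<inter> e3 = {}" "e1 \<inter> e3 = {}" | "e3 \<inter> e2 = {}" "e1 \<inter> e3 \<noteq> {}"
    | "e2 \<inter> e3 \<noteq> {}" "e3 \<inter> e1 = {}" | "e3 \<inter> e2 \<noteq> {}" "e1 \<inter> e3 \<noteq> {}"
    by blast
  then show ?thesis
  proof cases
    case 1
    have iso: "weighted_iso (weighted {e1, e2, e3} w) {({0::nat,1}, 1), ({2,3}, 2), ({4,5}, 3)}"
      unfolding W by (intro weighted_iso_matching[OF edges neq(1-3) disj 1(1,2)]) simp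
    have "internal_distances {e1, e2, e3} w = w ` {e1, e2, e3}"
      using acyclic(1) edges neq disj 1
      by (intro internal_distances_matching) (simp_all add: Int_commute)
    then have dist: "internal_distances {e1, e2, e3} w = {1,2,3}"
      using weights by simp
    show ?thesis
      by (rule leech_form[where q = 4, OF assms(1) C e1 e2 _ e3(1) _ _ iso dist])
         (simp_all add: three_edge_forms_def e3(2), auto)
  next
    case 2
    have "weighted_iso {(e1, 1), (e3, 3), (e2, 2)} {({0::nat,1}, 1), ({1,2}, 3), ({3,4}, 2)}"
      by (intro weighted_iso_path_edge[OF edges(1,3,2) neq(3,5,1) 2(2,1) disj]) simp
    then have iso: "weighted_iso (weighted {e1, e2, e3} w) {({0::nat,1}, 1), ({1,2}, 3), ({3,4}, 2)}"
      unfolding W by (simp add: insert_commute)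
    have "internal_distances {e1, e3, e2} w = {1,2,3,4}"
      using internal_distances_path_edge[OF acyclic(2) edges(1,3,2) neq(3,5,1) 2(2,1) disj] weights
      by (auto simp del: One_nat_def)
    then have dist: "internal_distances {e1, e2, e3} w = {1,2,3,4}"
      by (simp add: insert_commute)
    show ?thesis
      by (rule leech_form[where q = 5, OF assms(1) C e1 e2 _ e3(1) _ _ iso dist])
         (simp_all add: three_edge_forms_def e3(2), auto)
  next
    case 3
    have "e2 \<inter> e1 = {}" using disj by blast
    have "weighted_iso {(e2, 2), (e3, 3), (e1, 1)}
        {({2::nat,3}, 2), ({3,4}, 3), ({0,1}, 1)}"
      by (intro weighted_iso_path_edge[OF edges(2,3,1) neq(2,6,4) 3 \<open>e2 \<inter> e1 = {}\<close>]) simp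
    then have iso: "weighted_iso (weighted {e1, e2, e3} w) {({0::nat,1}, 1), ({2,3}, 2), ({3,4}, 3)}"
      unfolding W by (simp add: insert_commute)
    have "internal_distances {e2, e3, e1} w = {1,2,3,5}"
      using internal_distances_path_edge[OF acyclic(3) edges(2,3,1) neq(2,6,4) 3 \<open>e2 \<inter> e1 = {}\<close>] weights
      by (auto simp del: One_nat_def)
    then have dist: "internal_distances {e1, e2, e3} w = {1,2,3,5}"
      by (simp add: insert_commute)
    show ?thesis
      by (rule leech_form[where q = 4, OF assms(1) C e1 e2 _ e3(1) _ _ iso dist])
         (simp_all add: three_edge_forms_def e3(2), auto)
  next
    case 4
    have "weighted_iso {(e1, 1), (e3, 3), (e2, 2)} {({0::nat,1}, 1), ({1,2}, 3), ({2,3}, 2)}"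
      by (intro weighted_iso_path[OF edges(1,3,2) neq(3,5,1) 4(2,1) disj]) simp
    then have iso: "weighted_iso (weighted {e1, e2, e3} w) {({0::nat,1}, 1), ({1,2}, 3), ({2,3}, 2)}"
      unfolding W by (simp add: insert_commute)
    have "internal_distances {e1, e3, e2} w = {1,2,3,4,5,6}"
      using internal_distances_path[OF acyclic(2) edges(1,3,2) neq(3,5,1) 4(2,1) disj] weights
      by (auto simp del: One_nat_def)
    then have dist: "internal_distances {e1, e2, e3} w = {1,2,3,4,5,6}"
      by (simp add: insert_commute)
    show ?thesis
      by (rule leech_form[where q = 7, OF assms(1) C e1 e2 _ e3(1) _ _ iso dist])
         (simp_all add: three_edge_forms_def e3(2), auto)
  qed
qed

theorem theorem3p1:
  fixes V :: "'a set" and E :: "'a set set" and w :: "'a set \<Rightarrow> nat"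
  assumes "leech_tree V E w" and "5 \<le> card V"
  defines "F \<equiv> lightest_edges 3 E w"
  shows "\<exists>(S :: (nat set \<times> nat) set, D, q) \<in>
    {({({0,1}, 1), ({1,2}, 2), ({3,4}, 4)}, {1,2,3,4},     5),
     ({({0,1}, 4), ({1,2}, 1), ({2,3}, 2)}, {1,2,3,4,5,7}, 6),
     ({({0,1}, 1), ({1,2}, 2), ({2,3}, 4)}, {1,2,3,4,6,7}, 5),
     ({({0,1}, 1), ({0,2}, 2), ({0,3}, 4)}, {1,2,3,4,5,6}, 7),
     ({({0,1}, 1), ({2,3}, 2), ({4,5}, 3)}, {1,2,3},       4),
     ({({0,1}, 1), ({1,2}, 3), ({3,4}, 2)}, {1,2,3,4},     5),
     ({({0,1}, 1), ({2,3}, 2), ({3,4}, 3)}, {1,2,3,5},     4),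
     ({({0,1}, 1), ({1,2}, 3), ({2,3}, 2)}, {1,2,3,4,5,6}, 7)}.
    weighted_iso (weighted F w) S \<and> internal_distances F w = D \<and> Min (w ` (E - F)) = q"
proof -
  \<comment> \<open>Ten is the number of vertex pairs for order 5. It covers every mex used, the
    largest being 7; order 4 would supply only 6.\<close>
  have "5 * 4 div 2 \<le> card V * (card V - 1) div 2"
    using assms(2) by (intro div_le_mono mult_le_mono) auto
  then have C: "10 \<le> card V choose 2" by (simp add: choose_two)
  note edge = leech_tree_card_edge[OF assms(1)] and nc_sub = leech_tree_acyclic[OF assms(1)]
  \<comment> \<open>The mex principle starts from the empty forest, whose mex is 1; the single edge
    found then has mex 2.\<close>
  obtain e1 where e1: "e1 \<in> E" "w e1 = 1"
    using leech_next_edge[OF assms(1), of "{}" 1] C by (auto simp: internal_distances_empty)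
  have "internal_distances {e1} w = {1}"
    using internal_distances_edge[OF nc_sub edge] e1 by simp
  moreover have "{1..<2} \<subseteq> {1 :: nat}" by auto
  ultimately obtain e2 where e2: "e2 \<in> E" "w e2 = 2"
    using leech_next_edge[OF assms(1), of "{e1}" 2] e1(1) C by auto
  show ?thesis
    using leech_form_meeting[OF assms(1) C e1 e2] leech_form_disjoint[OF assms(1) C e1 e2]
    unfolding F_def three_edge_forms_def by blast
qed

end
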